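(* Fix $k_0\in\mathbb{N}$, an integer $k>k_0$, an integer $m\geq1$, arbitrary probability measures $\mu_0,\mu_1,\ldots$ on $\mathbb{N}=\{0,1,2,\ldots\}$, a partition of $\mathcal{T}_{k_0}$ into $m$ subsets $A_{k_0}^{(1)},\ldots,A_{k_0}^{(m)}$, and for each $l>k_0$ a partition of $\mathbb{N}^m$ into subsets $B_{l,1},\ldots,B_{l,m}$. Let $P_{lk}$ be the Galton-Watson measure on $\mathcal{T}_{k-l}$ and let $\tilde P_{lk}=\sum_{i=1}^m p_{lk}^{(i)}\tilde Q_{lk}^{(i)}$ be the associated $m$-type measure on $\mathcal{T}_{k-l}$, both as defined in the context. Then for all $0\leq l\leq k-k_0$ and all $T\in\mathcal{T}_{k-l}$, $$P_{lk}(T)=\tilde P_{lk}(T).$$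
   Context: **Trees.** $\mathbb{N}=\{0,1,2,\ldots\}$. The symbol $\mathbf{0}$ denotes the tree consisting only of the root. Set $\mathcal{T}_0=\{\mathbf{0}\}$ and inductively, for $k\geq 1$, $$\mathcal{T}_k=\{\mathbf{0}\}\sqcup\bigsqcup_{n=1}^\infty\{[T_1,\ldots,T_n] : T_i\in\mathcal{T}_{k-1}\},$$ where $[T_1,\ldots,T_n]$ is an ordered list. The trees $T_1,\ldots,T_n$ are the children of $[T_1,\ldots,T_n]$; $\mathbf{0}$ has no children. Write $\tilde T\prec T$ if $\tilde T$ is a child of $T$; counts and products over $\tilde T\prec T$ run over the positions in the list, i.e. children are counted with multiplicity. Each $\mathcal{T}_k$ is countable; for a measure $P$ on $\mathcal{T}_k$ write $P(T)$ for $P(\{T\})$. **Galton-Watson measure.** Let $\mu_0,\mu_1,\ldots$ be arbitrary probability measures on $\mathbb{N}$ ($\mu_l$ is the offspring distribution at height $l$), and let $W_l\sim\mu_l$. For $0\leq l\leq k$, $k\geq 1$, the probability measure $P_{lk}$ on $\mathcal{T}_{k-l}$ is defined as follows. $P_{kk}(\mathbf{0})=1$ (on $\mathcal{T}_0$). For $l<k$, $$P_{lk}(\mathbf{0})=\mathbb{P}(W_l=0),\qquad P_{lk}([T_1,\ldots,T_n])=\mathbb{P}(W_l=n)\prod_{i=1}^nP_{l+1,k}(T_i)$$ for $n\geq1$ and $T_1,\ldots,T_n\in\mathcal{T}_{k-l-1}$. **Types.** Starting from the given partition $A_{k_0}^{(1)},\ldots,A_{k_0}^{(m)}$ of $\mathcal{T}_{k_0}$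 and the given partitions $B_{l,1},\ldots,B_{l,m}$ of $\mathbb{N}^m$ ($l>k_0$), define recursively for $l>k_0$ the counting function $N_l:\mathcal{T}_l\to\mathbb{N}^m$, $$N_l(T)=(N_{l,1}(T),\ldots,N_{l,m}(T)),\qquad N_{l,i}(T)=\#\{\tilde T\prec T:\tilde T\in A_{l-1}^{(i)}\},$$ and the sets $$A_l^{(i)}=\{T\in\mathcal{T}_l:N_l(T)\in B_{l,i}\},\qquad i=1,\ldots,m,$$ which partition $\mathcal{T}_l$. For $0\leq l\leq k-k_0$ put $p_{lk}^{(i)}=P_{lk}(A_{k-l}^{(i)})$. **Auxiliary random vectors.** For $q\in[0,1]^m$ with $\sum_iq_i=1$, $\mathrm{Multi}(n,q)$ is the multinomial distribution distributing $n$ elements over $m$ types with probabilities $q_i$. For $0\leq l<k-k_0$ let $W_{lk}\sim\mu_l$ and let $X_{lk}=(X_{lk}^{(1)},\ldots,X_{lk}^{(m)})$ be such that, conditionally on $W_{lk}$, $X_{lk}\sim\mathrm{Multi}\big(W_{lk},(p_{l+1,k}^{(1)},\ldots,p_{l+1,k}^{(m)})\big)$, the pairs $(W_{lk},X_{lk})$ being independent over $l$. For $N\in\mathbb{N}^m$ let $$D(N)=\frac{(\sum_{i=1}^mN_i)!}{N_1!\cdots N_m!}.$$ **Measures $\tilde Q_{lk}^{(i)}$ on $\mathcal{T}_{k-l}$.** For $l=k-k_0$: for $T\in A_{k_0}^{(i)}$, $$\tilde Q_{k-k_0,k}^{(i)}(T)=\frac{P_{k-k_0,k}(T)}{P_{k-k_0,k}(A_{k_0}^{(i)})},$$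 and $\tilde Q_{k-k_0,k}^{(i)}(T)=0$ for $T\notin A_{k_0}^{(i)}$. For $0\leq l\leq k-k_0-1$, inductively, for $T\in\mathcal{T}_{k-l}$, $$\tilde Q_{lk}^{(i)}(T)=\frac{\mathbb{P}(X_{lk}=N_{k-l}(T)\mid X_{lk}\in B_{k-l,i})}{D(N_{k-l}(T))}\prod_{j=1}^m\ \prod_{\tilde T\prec T:\ \tilde T\in A_{k-l-1}^{(j)}}\tilde Q_{l+1,k}^{(j)}(\tilde T),$$ which equals $0$ whenever $T\notin A_{k-l}^{(i)}$. Empty products equal $1$. A conditional probability given an event of probability $0$, and a quotient with denominator $P_{k-k_0,k}(A_{k_0}^{(i)})=0$, are taken to be $0$. **The measure $\tilde P_{lk}$.** For $0\leq l\leq k-k_0$ and $T\in\mathcal{T}_{k-l}$, $$\tilde P_{lk}(T)=\sum_{i=1}^mp_{lk}^{(i)}\tilde Q_{lk}^{(i)}(T).$$ *)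

theory Defs
  imports "HOL-Probability.Probability"
begin

section \<open>Trees\<close>

text \<open>\<open>Node []\<close> is the tree consisting only of the root, written \<open>0\<close> in the mathematics.\<close>

datatype tree = Node (children: "tree list")

primrec trees :: "nat \<Rightarrow> tree set" where
  "trees 0 = {Node []}"
| "trees (Suc k) = {Node []} \<union> {Node ts | ts. ts \<noteq> [] \<and> set ts \<subseteq> trees k}"

section \<open>The Galton-Watson measure\<close>

text \<open>
  Point masses of \<open>P\<^bsub>lk\<^esub>\<close>, where \<open>\<mu> l\<close> is the offspring distribution at height \<open>l\<close>.
  The clause for \<open>Node []\<close> with \<open>l < k\<close> is the case of an empty product.
\<close>

function gw_mass :: "(nat \<Rightarrow> nat pmf) \<Rightarrow> nat \<Rightarrow> nat \<Rightarrow> tree \<Rightarrow> real" where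
  "gw_mass \<mu> l k T =
    (if l < k
     then pmf (\<mu> l) (length (children T)) * (\<Prod>S\<leftarrow>children T. gw_mass \<mu> (Suc l) k S)
     else if T = Node [] then 1 else 0)"
  by pat_completeness auto
termination by (relation "Wellfounded.measure (\<lambda>(\<mu>, l, k, T). k - l)") auto

declare gw_mass.simps [simp del]

definition gw_measure :: "(nat \<Rightarrow> nat pmf) \<Rightarrow> nat \<Rightarrow> nat \<Rightarrow> tree measure" where
  "gw_measure \<mu> l k = point_measure (trees (k - l)) (\<lambda>T. ennreal (gw_mass \<mu> l k T))"

section \<open>Types\<close>

text \<open>
  The \<open>m \<ge> 1\<close> types are the elements of an arbitrary finite type \<open>'m\<close>, so that \<open>\<nat>\<^sup>m\<close> becomes
  \<open>nat ^ 'm\<close>. Unlike for \<^const>\<open>partition_on\<close>, the parts are indexed and may be empty.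
\<close>

definition is_partition :: "'a set \<Rightarrow> ('m \<Rightarrow> 'a set) \<Rightarrow> bool" where
  "is_partition S A \<longleftrightarrow> disjoint_family A \<and> (\<Union>i. A i) = S"

definition type_counts :: "('m::finite \<Rightarrow> tree set) \<Rightarrow> tree \<Rightarrow> nat ^ 'm" where
  "type_counts A T = (\<chi> i. length (filter (\<lambda>S. S \<in> A i) (children T)))"

text \<open>
  \<open>type_sets k0 A0 B l i\<close> is \<open>A\<^sub>l\<^sup>(\<^sup>i\<^sup>)\<close> for \<open>l \<ge> k0\<close>; the values for \<open>l < k0\<close> are irrelevant.
\<close>

primrec type_sets ::
  "nat \<Rightarrow> ('m::finite \<Rightarrow> tree set) \<Rightarrow> (nat \<Rightarrow> 'm \<Rightarrow> (nat ^ 'm) set) \<Rightarrow> nat \<Rightarrow> 'm \<Rightarrow> tree set" where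
  "type_sets k0 A0 B 0 = A0"
| "type_sets k0 A0 B (Suc l) =
    (if Suc l \<le> k0 then A0
     else (\<lambda>i. {T \<in> trees (Suc l). type_counts (type_sets k0 A0 B l) T \<in> B (Suc l) i}))"

definition type_prob ::
  "(nat \<Rightarrow> nat pmf) \<Rightarrow> nat \<Rightarrow> ('m::finite \<Rightarrow> tree set) \<Rightarrow> (nat \<Rightarrow> 'm \<Rightarrow> (nat ^ 'm) set)
    \<Rightarrow> nat \<Rightarrow> nat \<Rightarrow> 'm \<Rightarrow> real" where
  "type_prob \<mu> k0 A0 B l k i = measure (gw_measure \<mu> l k) (type_sets k0 A0 B (k - l) i)"

section \<open>The auxiliary random vectors\<close>

definition multinomial_coeff :: "nat ^ 'm::finite \<Rightarrow> real" where
  "multinomial_coeff N = fact (\<Sum>i\<in>UNIV. N $ i) / (\<Prod>i\<in>UNIV. fact (N $ i))"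

text \<open>Point masses of \<open>Multi(n, q)\<close>.\<close>

definition multinomial_mass :: "nat \<Rightarrow> ('m::finite \<Rightarrow> real) \<Rightarrow> nat ^ 'm \<Rightarrow> real" where
  "multinomial_mass n q N =
    (if (\<Sum>i\<in>UNIV. N $ i) = n then multinomial_coeff N * (\<Prod>i\<in>UNIV. q i ^ (N $ i)) else 0)"

text \<open>
  The joint law of \<open>(W\<^bsub>lk\<^esub>, X\<^bsub>lk\<^esub>)\<close>. Everything below depends on these random variables only
  through this law, for one \<open>l\<close> at a time, so independence over \<open>l\<close> does not enter.
\<close>

definition WX_law ::
  "(nat \<Rightarrow> nat pmf) \<Rightarrow> nat \<Rightarrow> ('m::finite \<Rightarrow> tree set) \<Rightarrow> (nat \<Rightarrow> 'm \<Rightarrow> (nat ^ 'm) set)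
    \<Rightarrow> nat \<Rightarrow> nat \<Rightarrow> (nat \<times> (nat ^ 'm)) measure" where
  "WX_law \<mu> k0 A0 B l k = point_measure UNIV
    (\<lambda>(n, N). ennreal (pmf (\<mu> l) n * multinomial_mass n (type_prob \<mu> k0 A0 B (Suc l) k) N))"

section \<open>The multitype measures\<close>

text \<open>
  Point masses of \<open>Q\<^bsub>lk\<^esub>\<^sup>(\<^sup>i\<^sup>)\<close> (with tilde). Conditioning on a null event and dividing by \<open>0\<close>
  give \<open>0\<close>, by \<open>x / 0 = 0\<close>.
\<close>

function Q_mass ::
  "(nat \<Rightarrow> nat pmf) \<Rightarrow> nat \<Rightarrow> ('m::finite \<Rightarrow> tree set) \<Rightarrow> (nat \<Rightarrow> 'm \<Rightarrow> (nat ^ 'm) set)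
    \<Rightarrow> nat \<Rightarrow> nat \<Rightarrow> 'm \<Rightarrow> tree \<Rightarrow> real" where
  "Q_mass \<mu> k0 A0 B l k i T =
    (if l < k - k0
     then let N = type_counts (type_sets k0 A0 B (k - l - 1)) T in
       \<P>(\<omega> in WX_law \<mu> k0 A0 B l k. snd \<omega> = N \<bar> snd \<omega> \<in> B (k - l) i) / multinomial_coeff N *
       (\<Prod>j\<in>UNIV. \<Prod>S\<leftarrow>filter (\<lambda>S. S \<in> type_sets k0 A0 B (k - l - 1) j) (children T).
          Q_mass \<mu> k0 A0 B (Suc l) k j S)
     else if T \<in> A0 i
       then measure (gw_measure \<mu> l k) {T} / measure (gw_measure \<mu> l k) (A0 i)
       else 0)"
  by pat_completeness auto
termination by (relation "Wellfounded.measure (\<lambda>(\<mu>, k0, A0, B, l, k, i, T). k - l)") auto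

declare Q_mass.simps [simp del]

text \<open>The measure \<open>P\<^bsub>lk\<^esub>\<close> with tilde.\<close>

definition multitype_measure ::
  "(nat \<Rightarrow> nat pmf) \<Rightarrow> nat \<Rightarrow> ('m::finite \<Rightarrow> tree set) \<Rightarrow> (nat \<Rightarrow> 'm \<Rightarrow> (nat ^ 'm) set)
    \<Rightarrow> nat \<Rightarrow> nat \<Rightarrow> tree measure" where
  "multitype_measure \<mu> k0 A0 B l k = point_measure (trees (k - l))
    (\<lambda>T. ennreal (\<Sum>i\<in>UNIV. type_prob \<mu> k0 A0 B l k i * Q_mass \<mu> k0 A0 B l k i T))"

section \<open>Well-definedness\<close>

lemma pmf_replicate_pmf:
  "pmf (replicate_pmf n p) xs = (if length xs = n then (\<Prod>x\<leftarrow>xs. pmf p x) else 0)"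
proof (induction n arbitrary: xs)
  case 0
  then show ?case by simp
next
  case (Suc n)
  have eq: "replicate_pmf (Suc n) p = map_pmf (\<lambda>(y, ys). y # ys) (pair_pmf p (replicate_pmf n p))"
    by (simp add: pair_pmf_def map_bind_pmf)
  show ?case
  proof (cases xs)
    case Nil
    have "[] \<notin> set_pmf (replicate_pmf (Suc n) p)"
      by (simp add: set_replicate_pmf)
    with Nil show ?thesis by (simp add: set_pmf_iff del: replicate_pmf.simps)
  next
    case (Cons y ys)
    have "pmf (replicate_pmf (Suc n) p) ((\<lambda>(y, ys). y # ys) (y, ys)) = pmf (pair_pmf p (replicate_pmf n p)) (y, ys)"
      unfolding eq by (rule pmf_map_inj') (auto simp: inj_on_def)
    with Cons Suc.IH show ?thesis by (simp add: pmf_pair del: replicate_pmf.simps)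
  qed
qed

lemma gw_mass_pmf:
  "\<exists>p. (\<forall>T. pmf p T = gw_mass \<mu> l k T) \<and> set_pmf p \<subseteq> trees (k - l)"
proof (induction "k - l" arbitrary: l)
  case 0
  then show ?case
    by (intro exI[of _ "return_pmf (Node [])"]) (auto simp: gw_mass.simps indicator_def)
next
  case (Suc d)
  then have "d = k - Suc l" "l < k" by auto
  with Suc.hyps(1) obtain p where p: "\<And>T. pmf p T = gw_mass \<mu> (Suc l) k T"
    and supp: "set_pmf p \<subseteq> trees (k - Suc l)" by metis
  let ?q = "bind_pmf (\<mu> l) (\<lambda>n. map_pmf Node (replicate_pmf n p))"
  have "pmf ?q T = gw_mass \<mu> l k T" for T
  proof (cases T)
    case (Node ts)
    have "pmf ?q T = measure_pmf.expectation (\<mu> l) (\<lambda>n. pmf (replicate_pmf n p) ts)"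
      unfolding pmf_bind Node by (subst pmf_map_inj') (auto simp: inj_def)
    also have "\<dots> = measure_pmf.expectation (\<mu> l)
        (\<lambda>n. (\<Prod>x\<leftarrow>ts. pmf p x) * indicator {length ts} n)"
      by (intro Bochner_Integration.integral_cong) (auto simp: pmf_replicate_pmf)
    also have "\<dots> = gw_mass \<mu> l k T"
      using \<open>l < k\<close> Node by (simp add: p gw_mass.simps[of \<mu> l] measure_pmf_single)
    finally show ?thesis .
  qed
  moreover have "set_pmf ?q \<subseteq> trees (k - l)"
  proof -
    have "k - l = Suc (k - Suc l)" using \<open>l < k\<close> by simp
    then show ?thesis using supp by (auto simp: set_replicate_pmf)
  qed
  ultimately show ?case by blast
qed

lemma prob_space_gw_measure: "prob_space (gw_measure \<mu> l k)"
proof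
  obtain p where p: "\<And>T. pmf p T = gw_mass \<mu> l k T" "set_pmf p \<subseteq> trees (k - l)"
    using gw_mass_pmf by metis
  have "emeasure (gw_measure \<mu> l k) (space (gw_measure \<mu> l k))
      = (\<integral>\<^sup>+T. ennreal (pmf p T) * indicator (trees (k - l)) T \<partial>count_space (trees (k - l)))"
    by (simp add: gw_measure_def space_point_measure point_measure_def emeasure_density p)
  also have "\<dots> = (\<integral>\<^sup>+T. ennreal (pmf p T) \<partial>count_space (trees (k - l)))"
    by (intro nn_integral_cong) simp
  also have "\<dots> = 1"
    using p(2) by (auto simp: nn_integral_pmf AE_measure_pmf_iff intro!: measure_pmf.emeasure_eq_1_AE)
  finally show "emeasure (gw_measure \<mu> l k) (space (gw_measure \<mu> l k)) = 1" .
qed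

lemma is_partition_type_sets:
  assumes "is_partition (trees k0) A0" "\<And>h. k0 < h \<Longrightarrow> is_partition UNIV (B h)" "k0 \<le> l"
  shows "is_partition (trees l) (type_sets k0 A0 B l)"
proof (cases "l = k0")
  case True
  then show ?thesis using assms(1) by (cases l) auto
next
  case False
  then obtain h where l: "l = Suc h" "\<not> l \<le> k0" "k0 < l" using assms(3) by (cases l) auto
  have "is_partition UNIV (B l)" using assms(2) l by blast
  then show ?thesis using l unfolding is_partition_def disjoint_family_on_def
    by (auto simp del: trees.simps; blast)
qed

lemma sum_type_prob:
  assumes "is_partition (trees k0) A0" "\<And>h. k0 < h \<Longrightarrow> is_partition UNIV (B h)" "l < k - k0"
  shows "(\<Sum>i\<in>UNIV. type_prob \<mu> k0 A0 B (Suc l) k i) = 1"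
proof -
  interpret prob_space "gw_measure \<mu> (Suc l) k" by (rule prob_space_gw_measure)
  have P: "is_partition (trees (k - Suc l)) (type_sets k0 A0 B (k - Suc l))"
    using assms by (intro is_partition_type_sets) auto
  have "1 = prob (\<Union>i\<in>UNIV. type_sets k0 A0 B (k - Suc l) i)"
    using P prob_space by (simp add: is_partition_def gw_measure_def space_point_measure)
  also have "\<dots> = (\<Sum>i\<in>UNIV. type_prob \<mu> k0 A0 B (Suc l) k i)"
    unfolding type_prob_def
    by (rule finite_measure_finite_Union)
      (use P in \<open>auto simp: is_partition_def gw_measure_def sets_point_measure\<close>)
  finally show ?thesis by simp
qed

end

theory Submission
  imports Defs "HOL-Combinatorics.Multiset_Permutations"
begin

text \<open>
  Sorting the children by type factorises the Galton-Watson mass of \<open>T\<close> into the multinomial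
  weight of its count vector \<open>N(T)\<close> and the masses of the children conditioned on their types.
  By the recursive definition of the types, \<open>N(T)\<close> has the law of \<open>X\<^bsub>lk\<^esub>\<close>, so the type
  probability \<open>p\<^bsub>lk\<^esub>\<^sup>(\<^sup>i\<^sup>)\<close> is the probability of \<open>X\<^bsub>lk\<^esub> \<in> B\<^bsub>k-l,i\<^esub>\<close> and cancels
  against the conditioning in \<open>Q\<^bsub>lk\<^esub>\<^sup>(\<^sup>i\<^sup>)\<close>.
\<close>

section \<open>Measures given by point masses\<close>

lemma measure_point_measure_pmf:
  assumes "X \<subseteq> S"
  shows "measure (point_measure S (\<lambda>x. ennreal (pmf p x))) X = measure_pmf.prob p X"
proof -
  have "emeasure (point_measure S (\<lambda>x. ennreal (pmf p x))) X
      = (\<integral>\<^sup>+x. ennreal (pmf p x) * indicator X x \<partial>count_space S)"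
    using assms by (simp add: point_measure_def emeasure_density)
  also have "\<dots> = (\<integral>\<^sup>+x. ennreal (pmf p x) \<partial>count_space X)"
    using assms by (simp add: nn_integral_count_space_indicator mult.assoc indicator_inter_arith[symmetric] Int_absorb1 Int_absorb2)
  also have "\<dots> = emeasure (measure_pmf p) X"
    by (rule nn_integral_pmf)
  finally show ?thesis by (simp add: measure_def)
qed

lemma point_measure_UNIV_pmf: "point_measure UNIV (\<lambda>x. ennreal (pmf p x)) = measure_pmf p"
  by (simp add: point_measure_def measure_pmf_eq_density)

lemma measure_point_measure_singleton:
  assumes "x \<in> S" "0 \<le> f x"
  shows "measure (point_measure S (\<lambda>x. ennreal (f x))) {x} = f x"
  using assms by (simp add: measure_def emeasure_point_measure_finite2)

lemma map_replicate_pmf: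
  "map_pmf (map f) (replicate_pmf n p) = replicate_pmf n (map_pmf f p)"
proof (induction n)
  case (Suc n)
  show ?case
    by (simp add: Suc[symmetric] map_bind_pmf bind_map_pmf)
qed simp

section \<open>The multinomial law as the law of counts in an i.i.d. list\<close>

definition count_vec :: "'m::finite list \<Rightarrow> nat ^ 'm" where
  "count_vec xs = (\<chi> i. count_list xs i)"

text \<open>The lists with count vector \<open>N\<close> are the orderings of a single multiset
  \<open>M\<close>. They all have the same mass, a product of powers, and counting them gives the
  multinomial coefficient.\<close>

lemma prob_count_vec_replicate_pmf:
  fixes p :: "'m::finite pmf"
  shows "measure_pmf.prob (replicate_pmf n p) {xs. count_vec xs = N} = multinomial_mass n (pmf p) N"
proof -
  define M where "M = Abs_multiset (\<lambda>i. N $ i)"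
  have count_M: "count M i = N $ i" for i
    by (simp add: M_def count_Abs_multiset)
  have size_M: "size M = (\<Sum>i\<in>UNIV. N $ i)"
    unfolding size_multiset_overloaded_eq
    by (intro sum.mono_neutral_cong_left) (auto simp: count_M[symmetric] not_in_iff)
  have "card (permutations_of_multiset M) * (\<Prod>i\<in>set_mset M. fact (count M i)) = fact (size M)"
    by (simp add: card_permutations_of_multiset)
  \<comment> \<open>Types absent from \<open>M\<close> have count 0 and contribute
    \<open>fact 0 = 1\<close>, so the product extends to all types.\<close>
  also have "(\<Prod>i\<in>set_mset M. fact (count M i)) = (\<Prod>i\<in>UNIV. fact (N $ i) :: nat)"
    by (intro prod.mono_neutral_cong_left) (auto simp: count_M[symmetric] not_in_iff)
  finally have "real (card (permutations_of_multiset M) * (\<Prod>i\<in>UNIV. fact (N $ i)))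
      = fact (\<Sum>i\<in>UNIV. N $ i)"
    by (simp add: size_M)
  then have card: "real (card (permutations_of_multiset M)) = multinomial_coeff N"
    by (simp add: multinomial_coeff_def field_simps of_nat_prod)
  have eq: "{xs. count_vec xs = N} = permutations_of_multiset M"
    by (simp add: permutations_of_multiset_def multiset_eq_iff count_M count_vec_def vec_eq_iff count_mset)
  have "pmf (replicate_pmf n p) xs = (if size M = n then \<Prod>i\<in>UNIV. pmf p i ^ (N $ i) else 0)"
    if "xs \<in> permutations_of_multiset M" for xs
  proof -
    have M: "mset xs = M" using that by (simp add: permutations_of_multiset_def)
    have "(\<Prod>x\<leftarrow>xs. pmf p x) = prod_mset (image_mset (pmf p) M)"
      by (simp add: M[symmetric] prod_mset_prod_list[symmetric])
    also have "\<dots> = (\<Prod>i\<in>set_mset M. pmf p i ^ count M i)"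
      by (simp add: image_prod_mset_multiplicity)
    also have "\<dots> = (\<Prod>i\<in>UNIV. pmf p i ^ (N $ i))"
      by (intro prod.mono_neutral_cong_left) (auto simp: count_M[symmetric] not_in_iff)
    finally show ?thesis using M by (auto simp: pmf_replicate_pmf)
  qed
  then have "measure_pmf.prob (replicate_pmf n p) {xs. count_vec xs = N}
      = multinomial_coeff N * (if size M = n then \<Prod>i\<in>UNIV. pmf p i ^ (N $ i) else 0)"
    by (simp add: eq measure_measure_pmf_finite card)
  then show ?thesis by (simp add: multinomial_mass_def size_M)
qed

text \<open>Taking counts of i.i.d. types as the definition makes the law of the children's type
  counts multinomial by construction; the explicit point masses follow from the preceding
  lemma.\<close>

definition multinomial_pmf :: "nat \<Rightarrow> 'm::finite pmf \<Rightarrow> (nat ^ 'm) pmf" where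
  "multinomial_pmf n p = map_pmf count_vec (replicate_pmf n p)"

lemma pmf_multinomial_pmf: "pmf (multinomial_pmf n p) N = multinomial_mass n (pmf p) N"
  by (simp add: multinomial_pmf_def pmf_map vimage_def prob_count_vec_replicate_pmf)

section \<open>Type labels, and the Galton-Watson measure as a \<open>pmf\<close>\<close>

definition type_of :: "('m \<Rightarrow> 'a set) \<Rightarrow> 'a \<Rightarrow> 'm" where
  "type_of A x = (SOME i. x \<in> A i)"

text \<open>On \<open>S\<close> the parts cover and are disjoint, so the choice in
  \<open>type_of\<close> is forced. Outside \<open>S\<close> no part contains the point and the
  label is arbitrary.\<close>

lemma mem_part_iff:
  assumes "is_partition S A" "x \<in> S"
  shows "x \<in> A i \<longleftrightarrow> type_of A x = i"
proof -
  have "\<exists>j. x \<in> A j" using assms by (auto simp: is_partition_def)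
  then have "x \<in> A (type_of A x)" unfolding type_of_def by (rule someI_ex)
  then show ?thesis using assms by (auto simp: is_partition_def disjoint_family_on_def)
qed

lemma type_counts_eq_count_vec:
  assumes "is_partition S A" "set ts \<subseteq> S"
  shows "type_counts A (Node ts) = count_vec (map (type_of A) ts)"
  using assms(2)
proof (induction ts)
  case Nil
  then show ?case by (simp add: type_counts_def count_vec_def)
next
  case (Cons t ts)
  then show ?case
    using mem_part_iff[OF assms(1), of t] by (auto simp: type_counts_def count_vec_def vec_eq_iff)
qed

text \<open>A \<open>pmf\<close> is determined by its point masses, so the choice is unique. It
  lives on all trees, which allows \<open>bind_pmf\<close> and \<open>map_pmf\<close> across
  different heights.\<close>

definition gw_pmf :: "(nat \<Rightarrow> nat pmf) \<Rightarrow> nat \<Rightarrow> nat \<Rightarrow> tree pmf" where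
  "gw_pmf \<mu> l k = (SOME p. (\<forall>T. pmf p T = gw_mass \<mu> l k T) \<and> set_pmf p \<subseteq> trees (k - l))"

lemma pmf_gw_pmf: "pmf (gw_pmf \<mu> l k) = gw_mass \<mu> l k"
  and set_gw_pmf: "set_pmf (gw_pmf \<mu> l k) \<subseteq> trees (k - l)"
  using someI_ex[OF gw_mass_pmf[of \<mu> l k]] by (auto simp: gw_pmf_def fun_eq_iff)

lemma measure_gw_measure:
  "X \<subseteq> trees (k - l) \<Longrightarrow> measure (gw_measure \<mu> l k) X = measure_pmf.prob (gw_pmf \<mu> l k) X"
  by (simp add: gw_measure_def pmf_gw_pmf[symmetric] measure_point_measure_pmf)

text \<open>The branching property: draw the number of children from \<open>\<mu> l\<close>, then
  draw the children i.i.d. from the measure one level up. Only \<open>n = length ts\<close> can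
  produce \<open>Node ts\<close>, so the mixture collapses to a single term.\<close>

lemma gw_pmf_step:
  assumes "l < k"
  shows "gw_pmf \<mu> l k
    = bind_pmf (\<mu> l) (\<lambda>n. map_pmf Node (replicate_pmf n (gw_pmf \<mu> (Suc l) k)))"
    (is "_ = ?q")
proof (rule pmf_eqI)
  fix T
  obtain ts where T: "T = Node ts" by (cases T)
  have "pmf ?q T
      = measure_pmf.expectation (\<mu> l) (\<lambda>n. pmf (replicate_pmf n (gw_pmf \<mu> (Suc l) k)) ts)"
    unfolding pmf_bind T by (subst pmf_map_inj') (auto simp: inj_def)
  also have "\<dots> = measure_pmf.expectation (\<mu> l)
      (\<lambda>n. (\<Prod>S\<leftarrow>ts. gw_mass \<mu> (Suc l) k S) * indicator {length ts} n)"
    by (intro Bochner_Integration.integral_cong) (auto simp: pmf_replicate_pmf pmf_gw_pmf)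
  also have "\<dots> = gw_mass \<mu> l k T"
    using assms T by (simp add: gw_mass.simps[of \<mu> l] measure_pmf_single)
  finally show "pmf (gw_pmf \<mu> l k) T = pmf ?q T" by (simp add: pmf_gw_pmf)
qed

text \<open>Each entry \<open>x\<close> contributes to the factor \<open>j = c x\<close> only; the
  weights \<open>q j\<close> collect into powers given by the counts.\<close>

lemma prod_list_split_by_type:
  fixes f :: "'m::finite \<Rightarrow> 'a \<Rightarrow> real"
  shows "(\<Prod>x\<leftarrow>xs. q (c x) * f (c x) x)
    = (\<Prod>j\<in>UNIV. q j ^ count_vec (map c xs) $ j)
      * (\<Prod>j\<in>UNIV. \<Prod>x\<leftarrow>filter (\<lambda>x. c x = j) xs. f j x)"
proof (induction xs)
  case Nil
  then show ?case by (simp add: count_vec_def)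
next
  case (Cons x xs)
  have "(\<Prod>j\<in>UNIV. q j ^ count_vec (map c (x # xs)) $ j)
      = (\<Prod>j\<in>UNIV. (if c x = j then q j else 1) * q j ^ count_vec (map c xs) $ j)"
    by (intro prod.cong) (auto simp: count_vec_def)
  moreover have "(\<Prod>j\<in>UNIV. \<Prod>x\<leftarrow>filter (\<lambda>x. c x = j) (x # xs). f j x)
      = (\<Prod>j\<in>UNIV. (if c x = j then f j x else 1) * (\<Prod>x\<leftarrow>filter (\<lambda>x. c x = j) xs. f j x))"
    by (intro prod.cong) auto
  ultimately show ?case using Cons by (simp add: prod.distrib)
qed

lemma multinomial_coeff_pos: "0 < multinomial_coeff N"
  by (simp add: multinomial_coeff_def prod_pos)

section \<open>The law of the type counts and the type probabilities\<close>

context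
  fixes \<mu> :: "nat \<Rightarrow> nat pmf"
    and k0 k :: nat
    and A0 :: "'m::finite \<Rightarrow> tree set"
    and B :: "nat \<Rightarrow> 'm \<Rightarrow> (nat ^ 'm) set"
  assumes partition_A0: "is_partition (trees k0) A0"
    and partition_B: "\<And>h. k0 < h \<Longrightarrow> is_partition UNIV (B h)"
begin

abbreviation "A \<equiv> type_sets k0 A0 B"
abbreviation "p \<equiv> type_prob \<mu> k0 A0 B"
abbreviation "Q \<equiv> Q_mass \<mu> k0 A0 B"

definition "type_pmf l = map_pmf (type_of (A (k - l))) (gw_pmf \<mu> l k)"

definition "X_pmf l = bind_pmf (\<mu> l) (\<lambda>n. multinomial_pmf n (type_pmf (Suc l)))"

lemma partition_A: "l \<le> k - k0 \<Longrightarrow> k0 \<le> k \<Longrightarrow> is_partition (trees (k - l)) (A (k - l))"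
  using partition_A0 partition_B by (intro is_partition_type_sets) auto

lemma A_step:
  assumes "l < k - k0"
  shows "A (k - l) i = {T \<in> trees (k - l). type_counts (A (k - Suc l)) T \<in> B (k - l) i}"
proof -
  have "k - l = Suc (k - Suc l)" "\<not> k - l \<le> k0" using assms by auto
  then show ?thesis by (simp del: trees.simps)
qed

lemma type_prob_eq:
  assumes "l \<le> k - k0" "k0 \<le> k"
  shows "p l k i = measure_pmf.prob (gw_pmf \<mu> l k) (A (k - l) i)"
  using partition_A[OF assms] unfolding type_prob_def
  by (intro measure_gw_measure) (auto simp: is_partition_def)

lemma pmf_type_pmf:
  assumes "l \<le> k - k0" "k0 \<le> k"
  shows "pmf (type_pmf l) i = p l k i"
proof -
  have "pmf (type_pmf l) i = measure_pmf.prob (gw_pmf \<mu> l k) (type_of (A (k - l)) -` {i})"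
    by (simp add: type_pmf_def pmf_map)
  \<comment> \<open>The fibre of \<open>type_of\<close> and the part can differ only outside
    \<open>trees (k - l)\<close>, which is a null set.\<close>
  also have "\<dots> = p l k i"
    unfolding type_prob_eq[OF assms]
    using mem_part_iff[OF partition_A[OF assms]] set_gw_pmf
    by (intro measure_pmf.finite_measure_eq_AE) (auto simp: AE_measure_pmf_iff subset_iff)
  finally show ?thesis .
qed

text \<open>The children are i.i.d., hence so are their labels, with law
  \<open>type_pmf (Suc l)\<close>; counting labels gives the multinomial mixture
  \<open>X_pmf l\<close>.\<close>

lemma type_counts_law:
  assumes "l < k - k0"
  shows "map_pmf (type_counts (A (k - Suc l))) (gw_pmf \<mu> l k) = X_pmf l"
proof -
  have P: "is_partition (trees (k - Suc l)) (A (k - Suc l))"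
    using assms by (intro partition_A) auto
  have "map_pmf (\<lambda>ts. type_counts (A (k - Suc l)) (Node ts)) (replicate_pmf n (gw_pmf \<mu> (Suc l) k))
      = multinomial_pmf n (type_pmf (Suc l))" for n
    unfolding multinomial_pmf_def type_pmf_def map_replicate_pmf[symmetric] map_pmf_comp
    using set_gw_pmf[of \<mu> "Suc l" k]
    by (intro map_pmf_cong refl type_counts_eq_count_vec[OF P]) (auto simp: set_replicate_pmf)
  then show ?thesis
    using assms by (simp add: gw_pmf_step X_pmf_def map_bind_pmf map_pmf_comp)
qed

text \<open>Up to a null set, \<open>A (k - l) i\<close> is the preimage of
  \<open>B (k - l) i\<close> under the type counts, whose law is \<open>X_pmf l\<close>.\<close>

lemma type_prob_step:
  assumes "l < k - k0"
  shows "p l k i = measure_pmf.prob (X_pmf l) (B (k - l) i)"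
proof -
  have "p l k i = measure_pmf.prob (gw_pmf \<mu> l k) (A (k - l) i)"
    using assms by (intro type_prob_eq) auto
  also have "\<dots> = measure_pmf.prob (gw_pmf \<mu> l k) (type_counts (A (k - Suc l)) -` B (k - l) i)"
    using set_gw_pmf[of \<mu> l k] unfolding A_step[OF assms]
    by (intro measure_pmf.finite_measure_eq_AE) (auto simp: AE_measure_pmf_iff subset_iff)
  also have "\<dots> = measure_pmf.prob (X_pmf l) (B (k - l) i)"
    by (simp add: type_counts_law[OF assms, symmetric])
  finally show ?thesis .
qed

text \<open>Identifies the second marginal of \<open>WX_law\<close> with \<open>X_pmf l\<close>. The
  arbitrary predicate \<open>P\<close> serves both numerator and denominator of the conditional
  probability.\<close>

lemma measure_WX_law:
  assumes "l < k - k0"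
  shows "measure (WX_law \<mu> k0 A0 B l k) {\<omega>. P (snd \<omega>)} = measure_pmf.prob (X_pmf l) {N. P N}"
proof -
  define WX where "WX = bind_pmf (\<mu> l) (\<lambda>n. map_pmf (Pair n) (multinomial_pmf n (type_pmf (Suc l))))"
  have pmf: "pmf WX (n, N) = pmf (\<mu> l) n * multinomial_mass n (p (Suc l) k) N" for n N
  proof -
    have "pmf WX (n, N) = measure_pmf.expectation (\<mu> l)
        (\<lambda>n'. multinomial_mass n (p (Suc l) k) N * indicator {n} n')"
      unfolding WX_def pmf_bind
    proof (intro Bochner_Integration.integral_cong refl)
      fix n'
      have "pmf (map_pmf (Pair n') (multinomial_pmf n' (type_pmf (Suc l)))) (n, N) = 0" if "n' \<noteq> n"
        using that by (intro pmf_map_outside) auto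
      moreover have "pmf (type_pmf (Suc l)) = p (Suc l) k"
        using assms by (intro ext pmf_type_pmf) auto
      ultimately show "pmf (map_pmf (Pair n') (multinomial_pmf n' (type_pmf (Suc l)))) (n, N)
          = multinomial_mass n (p (Suc l) k) N * indicator {n} n'"
        by (cases "n' = n") (auto simp: pmf_map_inj' inj_def pmf_multinomial_pmf)
    qed
    then show ?thesis by (simp add: measure_pmf_single)
  qed
  have "WX_law \<mu> k0 A0 B l k = measure_pmf WX"
    unfolding WX_law_def point_measure_UNIV_pmf[symmetric]
    by (rule arg_cong[where f = "point_measure UNIV"]) (auto simp: pmf)
  moreover have "X_pmf l = map_pmf snd WX"
    by (simp add: X_pmf_def WX_def map_bind_pmf map_pmf_comp)
  ultimately show ?thesis by (simp add: vimage_def)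
qed

text \<open>A multinomial vector determines the number of elements distributed, so only one
  offspring number contributes to the mixture.\<close>

lemma pmf_X_pmf:
  assumes "l < k - k0"
  shows "pmf (X_pmf l) N = pmf (\<mu> l) (\<Sum>i\<in>UNIV. N $ i) * multinomial_mass (\<Sum>i\<in>UNIV. N $ i) (p (Suc l) k) N"
proof -
  have "pmf (type_pmf (Suc l)) = p (Suc l) k"
    using assms by (intro ext pmf_type_pmf) auto
  then have "pmf (X_pmf l) N = measure_pmf.expectation (\<mu> l)
      (\<lambda>n. multinomial_mass (\<Sum>i\<in>UNIV. N $ i) (p (Suc l) k) N * indicator {\<Sum>i\<in>UNIV. N $ i} n)"
    unfolding X_pmf_def pmf_bind
    by (intro Bochner_Integration.integral_cong) (auto simp: pmf_multinomial_pmf multinomial_mass_def)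
  then show ?thesis by (simp add: measure_pmf_single)
qed

text \<open>By \<open>type_prob_step\<close>, the factor \<open>p l k i\<close> is the probability
  of the conditioning event and cancels the denominator.\<close>

lemma cond_prob_WX_law:
  assumes "l < k - k0"
  shows "p l k i * \<P>(\<omega> in WX_law \<mu> k0 A0 B l k. snd \<omega> = N \<bar> snd \<omega> \<in> B (k - l) i)
    = (if N \<in> B (k - l) i then pmf (X_pmf l) N else 0)"
proof -
  have sp: "space (WX_law \<mu> k0 A0 B l k) = UNIV"
    by (simp add: WX_law_def space_point_measure)
  \<comment> \<open>This covers the null case: if the conditioning event has probability 0, the
    right-hand side is 0 as well, in agreement with \<open>x / 0 = 0\<close>.\<close>
  have le: "pmf (X_pmf l) N \<le> measure_pmf.prob (X_pmf l) (B (k - l) i)" if "N \<in> B (k - l) i"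
    unfolding measure_pmf_single[symmetric] using that by (intro measure_pmf.finite_measure_mono) auto
  have eq: "{N'. N' = N \<and> N' \<in> B (k - l) i} = (if N \<in> B (k - l) i then {N} else {})"
    by auto
  show ?thesis
    unfolding cond_prob_def sp
    using le pmf_nonneg[of "X_pmf l" N]
    by (auto simp: measure_WX_law[OF assms, of "\<lambda>N'. N' = N \<and> N' \<in> B (k - l) i"]
        measure_WX_law[OF assms, of "\<lambda>N'. N' \<in> B (k - l) i"]
        type_prob_step[OF assms] eq measure_pmf_single)
qed

section \<open>Factorisation of the Galton-Watson mass by types\<close>

lemma Q_mass_step:
  assumes "l < k - k0"
  shows "p l k i * Q l k i T =
    (let N = type_counts (A (k - Suc l)) T in
      (if N \<in> B (k - l) i then pmf (X_pmf l) N else 0) / multinomial_coeff N *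
      (\<Prod>j\<in>UNIV. \<Prod>S\<leftarrow>filter (\<lambda>S. S \<in> A (k - Suc l) j) (children T). Q (Suc l) k j S))"
  using assms by (subst Q_mass.simps) (simp add: Let_def cond_prob_WX_law[OF assms, symmetric])

text \<open>Downward induction on \<open>l\<close>, starting from \<open>k - k0\<close>. Keeping
  \<open>p l k i\<close> as a factor, instead of solving for \<open>Q\<close>, makes the identity
  valid also for types of probability 0.\<close>

lemma gw_mass_eq:
  assumes "l \<le> k - k0" "k0 \<le> k" "T \<in> trees (k - l)"
  shows "p l k i * Q l k i T = (if T \<in> A (k - l) i then gw_mass \<mu> l k T else 0)"
  using assms
proof (induction l arbitrary: T i rule: inc_induct)
  case base
  have A: "A k0 = A0" by (cases k0) auto
  have gw: "measure (gw_measure \<mu> (k - k0) k) {T} = gw_mass \<mu> (k - k0) k T"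
    using base by (subst measure_gw_measure) (auto simp: measure_pmf_single pmf_gw_pmf)
  interpret prob_space "gw_measure \<mu> (k - k0) k" by (rule prob_space_gw_measure)
  \<comment> \<open>In a null type every single tree has mass 0, so the convention for division by 0
    does no harm.\<close>
  have "prob {T} \<le> prob (A0 i)" if "T \<in> A0 i"
    using that partition_A0 base
    by (intro finite_measure_mono) (auto simp: gw_measure_def sets_point_measure is_partition_def)
  then have "prob (A0 i) = 0 \<Longrightarrow> T \<in> A0 i \<Longrightarrow> gw_mass \<mu> (k - k0) k T = 0"
    using gw measure_nonneg[of "gw_measure \<mu> (k - k0) k" "{T}"] by simp
  then show ?case
    using base by (auto simp: Q_mass.simps[of \<mu> k0 A0 B "k - k0"] type_prob_def A gw)
next
  case (step l)
  obtain ts where T: "T = Node ts" by (cases T)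
  have "k - l = Suc (k - Suc l)" using step by auto
  then have ts: "set ts \<subseteq> trees (k - Suc l)" using step T by auto
  have P: "is_partition (trees (k - Suc l)) (A (k - Suc l))"
    using step by (intro partition_A) auto
  define c where "c = type_of (A (k - Suc l))"
  define N where "N = type_counts (A (k - Suc l)) T"
  have c: "S \<in> A (k - Suc l) j \<longleftrightarrow> c S = j" if "S \<in> set ts" for S j
    using mem_part_iff[OF P] that ts by (auto simp: c_def)
  have N: "N = count_vec (map c ts)"
    unfolding N_def T c_def by (rule type_counts_eq_count_vec[OF P ts])
  have sum_N: "(\<Sum>i\<in>UNIV. N $ i) = length ts"
    using sum_count_set[of "map c ts" UNIV] by (simp add: N count_vec_def)
  let ?R = "\<Prod>j\<in>UNIV. \<Prod>S\<leftarrow>filter (\<lambda>S. S \<in> A (k - Suc l) j) ts. Q (Suc l) k j S"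
  \<comment> \<open>The induction hypothesis is applied to each child at its own type
    \<open>c S\<close>, where the case distinction selects the mass.\<close>
  have "gw_mass \<mu> (Suc l) k S = p (Suc l) k (c S) * Q (Suc l) k (c S) S" if "S \<in> set ts" for S
    using step.IH[of S "c S"] step.prems ts that c[OF that] by auto
  then have "(\<Prod>S\<leftarrow>ts. gw_mass \<mu> (Suc l) k S)
      = (\<Prod>S\<leftarrow>ts. p (Suc l) k (c S) * Q (Suc l) k (c S) S)"
    by (intro arg_cong[where f = prod_list] map_cong refl) auto
  also have "\<dots> = (\<Prod>j\<in>UNIV. p (Suc l) k j ^ N $ j) * ?R"
    unfolding N prod_list_split_by_type by (simp add: c cong: filter_cong)
  \<comment> \<open>The powers of the type probabilities, times the offspring mass at
    \<open>length ts\<close>, are the mass of \<open>X_pmf l\<close> at \<open>N\<close> without its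
    multinomial coefficient.\<close>
  finally have "gw_mass \<mu> l k T = pmf (X_pmf l) N / multinomial_coeff N * ?R"
    using multinomial_coeff_pos[of N] step
    by (simp add: gw_mass.simps[of \<mu> l] T pmf_X_pmf multinomial_mass_def sum_N)
  then show ?case
    using step by (simp add: Q_mass_step A_step N_def Let_def T)
qed

lemma measure_gw_eq_measure_multitype:
  assumes "l \<le> k - k0" "k0 \<le> k" "T \<in> trees (k - l)"
  shows "measure (gw_measure \<mu> l k) {T} = measure (multitype_measure \<mu> k0 A0 B l k) {T}"
proof -
  \<comment> \<open>\<open>T\<close> lies in exactly one type, so a single summand survives.\<close>
  have "(\<Sum>i\<in>UNIV. p l k i * Q l k i T)
      = (\<Sum>i\<in>UNIV. if type_of (A (k - l)) T = i then gw_mass \<mu> l k T else 0)"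
    by (simp add: gw_mass_eq[OF assms] mem_part_iff[OF partition_A[OF assms(1,2)] assms(3)])
  then have "(\<Sum>i\<in>UNIV. p l k i * Q l k i T) = gw_mass \<mu> l k T" by simp
  moreover have "0 \<le> gw_mass \<mu> l k T" by (simp flip: pmf_gw_pmf)
  ultimately show ?thesis
    using assms(3) by (simp add: gw_measure_def multitype_measure_def measure_point_measure_singleton)
qed

end

theorem theorem2:
  fixes \<mu> :: "nat \<Rightarrow> nat pmf"
    and k0 k l :: nat
    and A0 :: "'m::finite \<Rightarrow> tree set"
    and B :: "nat \<Rightarrow> 'm \<Rightarrow> (nat ^ 'm) set"
    and T :: tree
  assumes "k0 < k"
    and "is_partition (trees k0) A0"
    and "\<And>h. k0 < h \<Longrightarrow> is_partition UNIV (B h)"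
    and "l \<le> k - k0"
    and "T \<in> trees (k - l)"
  shows "measure (gw_measure \<mu> l k) {T} = measure (multitype_measure \<mu> k0 A0 B l k) {T}"
  using assms by (intro measure_gw_eq_measure_multitype) auto

end
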